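(* Let $0 \le \epsilon < \frac12$ be fixed. There is a constant $\alpha>0$ such that for all $k$ and $n$ with $n \ge \frac{1}{\alpha}k$, $$\mathsf{CC}^{\epsilon}(\mathsf{Par}_k^n) = \Omega(kn),$$ where the constant implicit in $\Omega$ may depend on $\epsilon$ but not on $k$ or $n$.
   Context: Model (asynchronous number-in-hand peer-to-peer model). There are $k$ players $1,\dots,k$. Player $i$ receives an input $x_i\in\mathcal{X}_i$, has a private random string $R_i$, and all players share a public random string $R^p$. Every pair of players is joined by a bidirectional link; messages are delivered in finite but unbounded time, in FIFO order in each direction. The view of player $i$ at a given time consists of $x_i$, $R_i$, $R^p$ and the messages read so far by player $i$. A protocol specifies, for each player $i$ and each local round $\ell\ge1$, functions of the view of player $i$ at the end of local round $\ell-1$ giving: a set $S_i^{\ell,s}\subseteq\{1,\dots,k\}\setminus\{i\}$ and, for each $j$ in it, a self-delimiting message $m_{i,j}^\ell\in\{0,1\}^*$ that player $i$ sends to $j$; a value $O_i^\ell\in\{0,1\}^*\cup\{\bot\}$ — if $O_i^\ell\neq\bot$, player $i$ stops and outputs $O_i^\ell$ (doing nothing further); otherwise a set $S_i^{\ell,r}\subseteq\{1,\dots,k\}\setminus\{i\}$ of players from each of which player $i$ then waits to read one complete message, which ends the local round. A protocol $\pi$ $\epsilon$-computes a function if for every input and every value of the random strings every player eventually stops, and for every input $x$, with probability at least $1-\epsilon$ every player required to output outputs the correct value. $\mathsf{CC}(\pi)$ is the maximum, over all inputs and all values of the randomness, of the total number of bits sent by all players, and $\mathsf{CC}^\epsilon(f)=\inf\{\mathsf{CC}(\pi):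 \pi\ \epsilon\text{-computes } f\}$. The function $\mathsf{Par}_k^n$: each player $i$ holds $(x_i^p)_{p=1}^n\in\{0,1\}^n$ and player $1$ must output $\mathsf{Par}_k^n(x)=(\oplus_{i=1}^k x_i^1,\dots,\oplus_{i=1}^k x_i^n)$.
   Formalization: The formal statement requires k ≥ 2: for k = 1 the single player already knows the answer, so the communication complexity is 0 and the bound Ω(kn) fails. *)

theory Defs
  imports "HOL-Probability.Probability" "HOL-Library.Sublist"
begin

text \<open>Players are the naturals in \<open>{1..k}\<close>; messages and outputs are bit strings.\<close>

type_synonym msg = "bool list"

text \<open>A random string is an infinite sequence of independent fair coins, so that protocols using
  only finitely many random bits, or any other distribution on the reals, are covered.  The first
  component of \<open>randomness\<close> is the public string, the second one gives the private strings.\<close>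

type_synonym coins = "nat \<Rightarrow> bool"
type_synonym randomness = "coins \<times> (nat \<Rightarrow> coins)"

definition coin_space :: "coins measure" where
  "coin_space = (\<Pi>\<^sub>M _\<in>UNIV. measure_pmf (bernoulli_pmf (1/2)))"

definition randomness_space :: "nat \<Rightarrow> randomness measure" where
  "randomness_space k = coin_space \<Otimes>\<^sub>M (\<Pi>\<^sub>M i\<in>{1..k}. coin_space)"

text \<open>The messages read are grouped by completed local round: an entry maps each player from which
  a message was read in that round to that message.  Hence a view with \<open>l\<close> entries is
  the view at the end of local round \<open>l\<close>, and the number of the next local round
  need not be a separate argument of the protocol.\<close>

type_synonym history = "(nat \<rightharpoonup> msg) list"

record 'x view =
  own_input :: 'x
  private_coins :: coins
  public_coins :: coins
  messages_read :: history

text \<open>Each field takes a player \<open>i\<close> and the view of \<open>i\<close> at the end of a local round, and describes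
  the next local round: the domain of \<open>send_fun\<close> is the set of players to which \<open>i\<close> sends
  a message, \<open>out_fun\<close> is the output (\<open>None\<close> for bottom), and \<open>wait_fun\<close> is the set of players
  from which \<open>i\<close> waits to read if it does not stop.\<close>

record 'x protocol =
  send_fun :: "nat \<Rightarrow> 'x view \<Rightarrow> (nat \<rightharpoonup> msg)"
  out_fun :: "nat \<Rightarrow> 'x view \<Rightarrow> msg option"
  wait_fun :: "nat \<Rightarrow> 'x view \<Rightarrow> nat set"

definition well_addressed :: "nat \<Rightarrow> 'x protocol \<Rightarrow> bool" where
  "well_addressed k \<pi> \<longleftrightarrow>
     (\<forall>i\<in>{1..k}. \<forall>v. dom (send_fun \<pi> i v) \<subseteq> {1..k} - {i} \<and> wait_fun \<pi> i v \<subseteq> {1..k} - {i})"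

text \<open>\<open>Ready\<close>: about to start a local round; \<open>Waiting\<close>: has sent the messages of the current local
  round and waits for messages.\<close>

datatype phase = Ready | Waiting | Stopped msg

text \<open>\<open>sent c i j\<close> lists, in order, all messages that \<open>i\<close> has sent to \<open>j\<close> so far,
  whether or not they have been read.\<close>

record config =
  phase :: "nat \<Rightarrow> phase"
  hist :: "nat \<Rightarrow> history"
  sent :: "nat \<Rightarrow> nat \<Rightarrow> msg list"

definition initial_config :: config where
  "initial_config = \<lparr>phase = (\<lambda>_. Ready), hist = (\<lambda>_. []), sent = (\<lambda>_ _. [])\<rparr>"

definition view_of :: "(nat \<Rightarrow> 'x) \<Rightarrow> randomness \<Rightarrow> config \<Rightarrow> nat \<Rightarrow> 'x view" where
  "view_of x \<omega> c i =
     \<lparr>own_input = x i, private_coins = snd \<omega> i, public_coins = fst \<omega>, messages_read = hist c i\<rparr>"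

text \<open>The FIFO queue of messages from \<open>j\<close> to \<open>i\<close> that \<open>i\<close> has not read yet.\<close>

definition unread :: "config \<Rightarrow> nat \<Rightarrow> nat \<Rightarrow> msg list" where
  "unread c j i = drop (length (List.map_filter (\<lambda>r. r j) (hist c i))) (sent c j i)"

text \<open>The effect of giving player \<open>i\<close> the opportunity to act; nothing happens if it has stopped or
  if some message it waits for is missing.\<close>

definition advance ::
    "'x protocol \<Rightarrow> (nat \<Rightarrow> 'x) \<Rightarrow> randomness \<Rightarrow> nat \<Rightarrow> config \<Rightarrow> config" where
  "advance \<pi> x \<omega> i c = (let v = view_of x \<omega> c i in
     case phase c i of
       Ready \<Rightarrow> c\<lparr>
         phase := (phase c)(i :=
           (case out_fun \<pi> i v of None \<Rightarrow> Waiting | Some y \<Rightarrow> Stopped y)),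
         sent := (sent c)(i := (\<lambda>j.
           case send_fun \<pi> i v j of None \<Rightarrow> sent c i j | Some m \<Rightarrow> sent c i j @ [m]))\<rparr>
     | Waiting \<Rightarrow>
         if \<forall>j\<in>wait_fun \<pi> i v. unread c j i \<noteq> [] then c\<lparr>
           phase := (phase c)(i := Ready),
           hist := (hist c)(i := hist c i @
             [\<lambda>j. if j \<in> wait_fun \<pi> i v then Some (hd (unread c j i)) else None])\<rparr>
         else c
     | Stopped y \<Rightarrow> c)"

text \<open>Asynchrony: a schedule says which player gets to act at each time.  The time between the
  sending and the delivery of a message is accounted for by the schedule, which may leave the receiver
  inactive for an arbitrary time, but only a finite one.\<close>

definition fair_schedules :: "nat \<Rightarrow> (nat \<Rightarrow> nat) set" where
  "fair_schedules k = {\<sigma>. range \<sigma> \<subseteq> {1..k} \<and> (\<forall>i\<in>{1..k}. infinite {t. \<sigma> t = i})}"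

primrec run ::
    "'x protocol \<Rightarrow> (nat \<Rightarrow> 'x) \<Rightarrow> randomness \<Rightarrow> (nat \<Rightarrow> nat) \<Rightarrow> nat \<Rightarrow> config" where
  "run \<pi> x \<omega> \<sigma> 0 = initial_config"
| "run \<pi> x \<omega> \<sigma> (Suc t) = advance \<pi> x \<omega> (\<sigma> t) (run \<pi> x \<omega> \<sigma> t)"

text \<open>Messages are self-delimiting: the strings that player \<open>i\<close>, waiting with a given view, may
  find as the next message from \<open>j\<close> are prefix-free, so that \<open>i\<close> can tell where the message ends.
  Messages from a fixed prefix-free code, or of a length known to the receiver, satisfy this.\<close>

definition self_delimiting :: "nat \<Rightarrow> (nat \<Rightarrow> 'x) set \<Rightarrow> 'x protocol \<Rightarrow> bool" where
  "self_delimiting k X \<pi> \<longleftrightarrow>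
     (\<forall>x\<in>X. \<forall>\<omega>\<in>space (randomness_space k). \<forall>\<sigma>\<in>fair_schedules k. \<forall>t.
      \<forall>x'\<in>X. \<forall>\<omega>'\<in>space (randomness_space k). \<forall>\<sigma>'\<in>fair_schedules k. \<forall>t'.
        let c = run \<pi> x \<omega> \<sigma> t; c' = run \<pi> x' \<omega>' \<sigma>' t' in
        \<forall>i\<in>{1..k}. \<forall>j\<in>wait_fun \<pi> i (view_of x \<omega> c i).
          phase c i = Waiting \<and> phase c' i = Waiting \<and>
          view_of x \<omega> c i = view_of x' \<omega>' c' i \<and>
          unread c j i \<noteq> [] \<and> unread c' j i \<noteq> [] \<longrightarrow>
          \<not> strict_prefix (hd (unread c j i)) (hd (unread c' j i)))"

text \<open>A function with input set \<open>X\<close> is given by \<open>f\<close>, where \<open>f x i = Some y\<close> if player \<open>i\<close> must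
  output \<open>y\<close> on input \<open>x\<close>, and \<open>f x i = None\<close> if \<open>i\<close> may stop with any output.\<close>

definition outputs_correct ::
    "nat \<Rightarrow> ((nat \<Rightarrow> 'x) \<Rightarrow> nat \<Rightarrow> msg option) \<Rightarrow> 'x protocol \<Rightarrow> (nat \<Rightarrow> 'x) \<Rightarrow> randomness \<Rightarrow> bool" where
  "outputs_correct k f \<pi> x \<omega> \<longleftrightarrow>
     (\<forall>\<sigma>\<in>fair_schedules k. \<forall>i\<in>{1..k}. \<forall>y. f x i = Some y \<longrightarrow>
        (\<exists>t. phase (run \<pi> x \<omega> \<sigma> t) i = Stopped y))"

definition eps_computes ::
    "nat \<Rightarrow> (nat \<Rightarrow> 'x) set \<Rightarrow> ((nat \<Rightarrow> 'x) \<Rightarrow> nat \<Rightarrow> msg option) \<Rightarrow> real \<Rightarrow> 'x protocol \<Rightarrow> bool" where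
  "eps_computes k X f \<epsilon> \<pi> \<longleftrightarrow>
     (\<forall>x\<in>X. \<forall>\<omega>\<in>space (randomness_space k). \<forall>\<sigma>\<in>fair_schedules k. \<forall>i\<in>{1..k}.
        \<exists>t y. phase (run \<pi> x \<omega> \<sigma> t) i = Stopped y) \<and>
     (\<forall>x\<in>X.
        {\<omega> \<in> space (randomness_space k). outputs_correct k f \<pi> x \<omega>} \<in> sets (randomness_space k) \<and>
        measure (randomness_space k)
          {\<omega> \<in> space (randomness_space k). outputs_correct k f \<pi> x \<omega>} \<ge> 1 - \<epsilon>)"

definition bits_sent :: "nat \<Rightarrow> config \<Rightarrow> nat" where
  "bits_sent k c = (\<Sum>i=1..k. \<Sum>j=1..k. sum_list (map length (sent c i j)))"

text \<open>The values are in \<open>enat\<close>, since with infinite random strings the number of bits need not be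
  bounded over all values of the randomness.\<close>

definition CC_protocol :: "nat \<Rightarrow> (nat \<Rightarrow> 'x) set \<Rightarrow> 'x protocol \<Rightarrow> enat" where
  "CC_protocol k X \<pi> =
     (SUP x\<in>X. SUP \<omega>\<in>space (randomness_space k). SUP \<sigma>\<in>fair_schedules k. SUP t.
        enat (bits_sent k (run \<pi> x \<omega> \<sigma> t)))"

definition CC_eps ::
    "nat \<Rightarrow> (nat \<Rightarrow> 'x) set \<Rightarrow> ((nat \<Rightarrow> 'x) \<Rightarrow> nat \<Rightarrow> msg option) \<Rightarrow> real \<Rightarrow> enat" where
  "CC_eps k X f \<epsilon> =
     Inf (CC_protocol k X ` {\<pi>. well_addressed k \<pi> \<and> self_delimiting k X \<pi> \<and> eps_computes k X f \<epsilon> \<pi>})"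

definition Par_inputs :: "nat \<Rightarrow> nat \<Rightarrow> (nat \<Rightarrow> bool list) set" where
  "Par_inputs k n = (\<Pi>\<^sub>E i\<in>{1..k}. {w. length w = n})"

definition Par :: "nat \<Rightarrow> nat \<Rightarrow> (nat \<Rightarrow> bool list) \<Rightarrow> nat \<Rightarrow> msg option" where
  "Par k n x i =
     (if i = 1 then Some (map (\<lambda>p. odd (\<Sum>j=1..k. of_bool (x j ! p) :: nat)) [0..<n]) else None)"

end

theory Submission imports Defs begin

text \<open>Averaging over the inputs fixes a value of the randomness for which the protocol is correct on
  at least half of the inputs; the schedule is fixed to be round robin.  For a player \<open>i \<noteq> 1\<close>, the bit
  streams sent by \<open>i\<close> to each of the others and the inputs of the others determine the output of
  player 1, independently of delays, because messages are self-delimiting.  A correct output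
  and the inputs of the others determine the input of \<open>i\<close>, so for each choice of the latter there are
  at most as many correct inputs on which \<open>i\<close> sends at most \<open>L\<close> bits as there are \<open>k\<close>-tuples of
  strings of total length at most \<open>L\<close>, that is at most \<open>4 ^ (L + k)\<close>.  For \<open>L = n div 8\<close> and \<open>n \<ge> 8 k\<close>
  this is at most \<open>2 ^ n / 4\<close>; hence on a quarter of all inputs player \<open>i\<close> sends at
  least \<open>n / 8\<close> bits, and summing over \<open>i\<close> shows that some input costs at least
  \<open>(k - 1) n / 32\<close> bits.\<close>

section \<open>Filtered lists and the effect of one step\<close>

lemma map_filter_append:
  "List.map_filter f (xs @ ys) = List.map_filter f xs @ List.map_filter f ys"
  by (simp add: List.map_filter_def)

lemma map_filter_cong:
  "(\<And>x. x \<in> set xs \<Longrightarrow> f x = g x) \<Longrightarrow> List.map_filter f xs = List.map_filter g xs"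
  unfolding List.map_filter_def by (induction xs) auto

lemma prefix_map_filter: "prefix xs ys \<Longrightarrow> prefix (List.map_filter f xs) (List.map_filter f ys)"
  by (auto simp: prefix_def map_filter_append)

lemma prefix_take_eq: "prefix xs ys \<Longrightarrow> r \<le> length xs \<Longrightarrow> take r xs = take r ys"
  by (auto simp: prefix_def)

text \<open>The view as a function of the history alone, so that truncated histories and histories
  from different configurations can be compared.\<close>

definition local_view :: "(nat \<Rightarrow> 'x) \<Rightarrow> randomness \<Rightarrow> nat \<Rightarrow> history \<Rightarrow> 'x view" where
  "local_view x \<omega> i h =
     \<lparr>own_input = x i, private_coins = snd \<omega> i, public_coins = fst \<omega>, messages_read = h\<rparr>"

lemma view_of_eq: "view_of x \<omega> c i = local_view x \<omega> i (hist c i)"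
  by (simp add: view_of_def local_view_def)

text \<open>Messages leave at the start of a local round, so a player that waits or has stopped has
  sent once more often than it has completed rounds.\<close>

definition rounds_started :: "config \<Rightarrow> nat \<Rightarrow> nat" where
  "rounds_started c i = (if phase c i = Ready then length (hist c i) else Suc (length (hist c i)))"

lemma advance_other:
  "i \<noteq> j \<Longrightarrow> phase (advance \<pi> x \<omega> j c) i = phase c i"
  "i \<noteq> j \<Longrightarrow> hist (advance \<pi> x \<omega> j c) i = hist c i"
  "i \<noteq> j \<Longrightarrow> sent (advance \<pi> x \<omega> j c) i = sent c i"
  by (auto simp: advance_def Let_def split: phase.splits)

lemma advance_ready:
  assumes "phase c i = Ready"
  shows "phase (advance \<pi> x \<omega> i c) i =
      (case out_fun \<pi> i (local_view x \<omega> i (hist c i)) of None \<Rightarrow> Waiting | Some y \<Rightarrow> Stopped y)"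
    and "hist (advance \<pi> x \<omega> i c) i = hist c i"
    and "sent (advance \<pi> x \<omega> i c) i j = sent c i j @
      List.map_filter (\<lambda>r. send_fun \<pi> i (local_view x \<omega> i (take r (hist c i))) j) [length (hist c i)]"
  using assms by (auto simp: advance_def Let_def view_of_eq List.map_filter_def split: option.splits)

lemma advance_waiting:
  assumes "phase c i = Waiting"
    and "\<forall>j\<in>wait_fun \<pi> i (local_view x \<omega> i (hist c i)). unread c j i \<noteq> []"
  shows "phase (advance \<pi> x \<omega> i c) i = Ready"
    and "hist (advance \<pi> x \<omega> i c) i = hist c i @
      [\<lambda>j. if j \<in> wait_fun \<pi> i (local_view x \<omega> i (hist c i)) then Some (hd (unread c j i)) else None]"
    and "sent (advance \<pi> x \<omega> i c) = sent c"
  using assms by (auto simp: advance_def Let_def view_of_eq)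

lemma advance_blocked:
  assumes "phase c i = Waiting"
    and "\<not> (\<forall>j\<in>wait_fun \<pi> i (local_view x \<omega> i (hist c i)). unread c j i \<noteq> [])"
  shows "advance \<pi> x \<omega> i c = c"
  using assms by (auto simp: advance_def Let_def view_of_eq)

lemma advance_stopped: "phase c i = Stopped y \<Longrightarrow> advance \<pi> x \<omega> i c = c"
  by (simp add: advance_def Let_def)

text \<open>Case rule for the invariants of runs; \<open>idle\<close> merges a stopped player with
  one whose awaited messages are missing.\<close>

lemma advance_cases [case_names other ready waiting idle]:
  assumes "i \<noteq> j \<Longrightarrow> P"
    and "i = j \<Longrightarrow> phase c i = Ready \<Longrightarrow> P"
    and "i = j \<Longrightarrow> phase c i = Waiting \<Longrightarrow>
      \<forall>j\<in>wait_fun \<pi> i (local_view x \<omega> i (hist c i)). unread c j i \<noteq> [] \<Longrightarrow> P"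
    and "i = j \<Longrightarrow> advance \<pi> x \<omega> i c = c \<Longrightarrow> P"
  shows P
  using assms advance_blocked advance_stopped by (metis phase.exhaust)

lemma advance_prefix:
  "prefix (hist c i) (hist (advance \<pi> x \<omega> j c) i)"
  "prefix (sent c i l) (sent (advance \<pi> x \<omega> j c) i l)"
proof -
  have "prefix (hist c i) (hist (advance \<pi> x \<omega> j c) i) \<and>
      prefix (sent c i l) (sent (advance \<pi> x \<omega> j c) i l)"
  proof (cases rule: advance_cases[of i j _ c \<pi> x \<omega>])
    case other then show ?thesis by (simp add: advance_other)
  next
    case ready then show ?thesis using advance_ready(2,3)[OF ready(2), of \<pi> x \<omega>] by simp
  next
    case waiting then show ?thesis using advance_waiting(2,3)[OF waiting(2,3)] by simp
  next
    case idle then show ?thesis by simp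
  qed
  then show "prefix (hist c i) (hist (advance \<pi> x \<omega> j c) i)"
    and "prefix (sent c i l) (sent (advance \<pi> x \<omega> j c) i l)" by auto
qed

section \<open>Invariants of runs\<close>

lemma run_prefix:
  assumes "s \<le> t"
  shows "prefix (hist (run \<pi> x \<omega> \<sigma> s) i) (hist (run \<pi> x \<omega> \<sigma> t) i)"
    and "prefix (sent (run \<pi> x \<omega> \<sigma> s) i l) (sent (run \<pi> x \<omega> \<sigma> t) i l)"
  using assms
  by (induction t rule: dec_induct) (auto intro: prefix_order.trans advance_prefix)

lemma run_stopped:
  assumes "s \<le> t" "phase (run \<pi> x \<omega> \<sigma> s) i = Stopped y"
  shows "phase (run \<pi> x \<omega> \<sigma> t) i = Stopped y"
  using assms
proof (induction t rule: dec_induct)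
  case (step t)
  then show ?case
    by (cases "i = \<sigma> t") (auto simp: advance_other advance_stopped)
qed simp

text \<open>Since histories only grow, the view on which round \<open>r\<close> acted can be
  recovered later by truncating to \<open>r\<close> entries. Hence input, coins and history of a
  player fix what it has sent.\<close>

lemma run_sent:
  "sent (run \<pi> x \<omega> \<sigma> t) i j =
     List.map_filter (\<lambda>r. send_fun \<pi> i (local_view x \<omega> i (take r (hist (run \<pi> x \<omega> \<sigma> t) i))) j)
       [0..<rounds_started (run \<pi> x \<omega> \<sigma> t) i]"
proof (induction t)
  case 0
  then show ?case by (simp add: initial_config_def rounds_started_def List.map_filter_def)
next
  case (Suc t)
  let ?c = "run \<pi> x \<omega> \<sigma> t"
  show ?case
  proof (cases rule: advance_cases[of i "\<sigma> t" _ ?c \<pi> x \<omega>])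
    case other then show ?thesis using Suc by (simp add: advance_other rounds_started_def)
  next
    case ready
    have "rounds_started (advance \<pi> x \<omega> i ?c) i = Suc (length (hist ?c i))"
      using advance_ready(1,2)[OF ready(2), of \<pi> x \<omega>] by (auto simp: rounds_started_def split: option.splits)
    moreover have "rounds_started ?c i = length (hist ?c i)"
      using ready by (simp add: rounds_started_def)
    ultimately show ?thesis
      using Suc ready(1) advance_ready(2,3)[OF ready(2), of \<pi> x \<omega>] by (simp add: map_filter_append)
  next
    case waiting
    let ?c' = "advance \<pi> x \<omega> i ?c"
    \<comment> \<open>Reading lengthens the history by one and returns the player to
      \<open>Ready\<close>; the two changes cancel in \<open>rounds_started\<close>.\<close>
    have "rounds_started ?c' i = Suc (length (hist ?c i))" "rounds_started ?c i = Suc (length (hist ?c i))"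
      using waiting advance_waiting(1,2)[OF waiting(2,3)] by (auto simp: rounds_started_def)
    moreover have "take r (hist ?c' i) = take r (hist ?c i)" if "r < Suc (length (hist ?c i))" for r
      using that advance_waiting(2)[OF waiting(2,3)] by simp
    ultimately show ?thesis
      using Suc advance_waiting(3)[OF waiting(2,3)] unfolding run.simps waiting(1)[symmetric]
      by (metis (no_types, lifting) map_filter_cong atLeastLessThan_iff set_upt)
  next
    case idle then show ?thesis using Suc by simp
  qed
qed

text \<open>Serves to compare histories: a strict prefix of a reached history yields no output,
  whereas the whole history of a stopped player does.\<close>

lemma run_out:
  "(\<forall>r<length (hist (run \<pi> x \<omega> \<sigma> t) i).
      out_fun \<pi> i (local_view x \<omega> i (take r (hist (run \<pi> x \<omega> \<sigma> t) i))) = None) \<and>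
   (case phase (run \<pi> x \<omega> \<sigma> t) i of Ready \<Rightarrow> True
    | Waiting \<Rightarrow> out_fun \<pi> i (local_view x \<omega> i (hist (run \<pi> x \<omega> \<sigma> t) i)) = None
    | Stopped y \<Rightarrow> out_fun \<pi> i (local_view x \<omega> i (hist (run \<pi> x \<omega> \<sigma> t) i)) = Some y)"
proof (induction t)
  case 0
  then show ?case by (simp add: initial_config_def)
next
  case (Suc t)
  let ?c = "run \<pi> x \<omega> \<sigma> t"
  show ?case
  proof (cases rule: advance_cases[of i "\<sigma> t" _ ?c \<pi> x \<omega>])
    case other then show ?thesis using Suc by (cases "phase ?c i") (simp_all add: advance_other)
  next
    case ready
    then show ?thesis
      using Suc advance_ready(1,2)[OF ready(2), of \<pi> x \<omega>] by (auto split: option.splits)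
  next
    case waiting
    then show ?thesis
      using Suc advance_waiting(1,2)[OF waiting(2,3)] by (auto simp: less_Suc_eq)
  next
    case idle
    then have step: "run \<pi> x \<omega> \<sigma> (Suc t) = ?c" by simp
    show ?thesis unfolding step by (rule Suc)
  qed
qed

text \<open>Recovers the moment at which a history entry was written. The player then waits with the
  truncated history, which is the situation that \<open>self_delimiting\<close> speaks
  about.\<close>

lemma run_read:
  assumes "r < length (hist (run \<pi> x \<omega> \<sigma> t) i)"
  obtains s where "s \<le> t" "phase (run \<pi> x \<omega> \<sigma> s) i = Waiting"
    "hist (run \<pi> x \<omega> \<sigma> s) i = take r (hist (run \<pi> x \<omega> \<sigma> t) i)"
    "\<forall>j\<in>wait_fun \<pi> i (local_view x \<omega> i (hist (run \<pi> x \<omega> \<sigma> s) i)). unread (run \<pi> x \<omega> \<sigma> s) j i \<noteq> []"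
    "hist (run \<pi> x \<omega> \<sigma> t) i ! r =
       (\<lambda>j. if j \<in> wait_fun \<pi> i (local_view x \<omega> i (hist (run \<pi> x \<omega> \<sigma> s) i))
            then Some (hd (unread (run \<pi> x \<omega> \<sigma> s) j i)) else None)"
  using assms
proof (induction t arbitrary: thesis)
  case 0
  then show ?case by (simp add: initial_config_def)
next
  case (Suc t)
  let ?c = "run \<pi> x \<omega> \<sigma> t"
  show ?case
  proof (cases "r < length (hist ?c i)")
    case True
    obtain zs where zs: "hist (run \<pi> x \<omega> \<sigma> (Suc t)) i = hist ?c i @ zs"
      using run_prefix(1)[of t "Suc t" \<pi> x \<omega> \<sigma> i] by (auto simp: prefix_def)
    obtain s where s: "s \<le> t" "phase (run \<pi> x \<omega> \<sigma> s) i = Waiting"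
      "hist (run \<pi> x \<omega> \<sigma> s) i = take r (hist ?c i)"
      "\<forall>j\<in>wait_fun \<pi> i (local_view x \<omega> i (hist (run \<pi> x \<omega> \<sigma> s) i)). unread (run \<pi> x \<omega> \<sigma> s) j i \<noteq> []"
      "hist ?c i ! r =
         (\<lambda>j. if j \<in> wait_fun \<pi> i (local_view x \<omega> i (hist (run \<pi> x \<omega> \<sigma> s) i))
              then Some (hd (unread (run \<pi> x \<omega> \<sigma> s) j i)) else None)"
      using Suc.IH True by blast
    have "hist (run \<pi> x \<omega> \<sigma> (Suc t)) i ! r = hist ?c i ! r"
      and "take r (hist (run \<pi> x \<omega> \<sigma> (Suc t)) i) = take r (hist ?c i)"
      using True by (simp_all only: zs nth_append) simp_all
    then show ?thesis using s Suc.prems(1)[of s] by (metis le_SucI)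
  next
    case False
    then have new: "length (hist ?c i) < length (hist (advance \<pi> x \<omega> (\<sigma> t) ?c) i)"
      using Suc.prems(2) by simp
    show ?thesis
    proof (cases rule: advance_cases[of i "\<sigma> t" _ ?c \<pi> x \<omega>])
      case other then show ?thesis using new by (simp add: advance_other)
    next
      case ready
      then show ?thesis using new advance_ready(2)[OF ready(2), of \<pi> x \<omega>] by simp
    next
      case waiting
      have h: "hist (run \<pi> x \<omega> \<sigma> (Suc t)) i = hist ?c i @
        [\<lambda>j. if j \<in> wait_fun \<pi> i (local_view x \<omega> i (hist ?c i))
             then Some (hd (unread ?c j i)) else None]"
        using advance_waiting(2)[OF waiting(2,3)] waiting(1) by simp
      then have r: "r = length (hist ?c i)" using False Suc.prems(2) by simp
      show ?thesis
        by (rule Suc.prems(1)[OF le_SucI[OF order_refl] waiting(2) _ waiting(3)])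
          (unfold h r, simp_all only: take_append nth_append_length, simp_all)
    next
      case idle then show ?thesis using new by simp
    qed
  qed
qed


text \<open>FIFO delivery: each read takes the head of the queue, so the messages read form an
  initial segment of those sent.\<close>

lemma messages_read_prefix_sent:
  "prefix (List.map_filter (\<lambda>r. r j) (hist (run \<pi> x \<omega> \<sigma> t) i)) (sent (run \<pi> x \<omega> \<sigma> t) j i)"
proof (induction t)
  case 0
  then show ?case by (simp add: initial_config_def List.map_filter_def)
next
  case (Suc t)
  let ?c = "run \<pi> x \<omega> \<sigma> t"
  have mono: "prefix (sent ?c j i) (sent (advance \<pi> x \<omega> (\<sigma> t) ?c) j i)"
    by (rule advance_prefix(2))
  show ?case
  proof (cases rule: advance_cases[of i "\<sigma> t" _ ?c \<pi> x \<omega>])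
    case other
    then show ?thesis
      using Suc mono by (auto simp: advance_other intro: prefix_order.trans)
  next
    case ready
    then show ?thesis
      using Suc mono advance_ready(2)[OF ready(2), of \<pi> x \<omega>] by (auto intro: prefix_order.trans)
  next
    case waiting
    let ?R = "List.map_filter (\<lambda>r. r j) (hist ?c i)"
    obtain zs where zs: "sent ?c j i = ?R @ zs" using Suc by (auto simp: prefix_def)
    then have "unread ?c j i = zs" by (simp add: unread_def)
    then show ?thesis
      using waiting zs advance_waiting(2,3)[OF waiting(2,3)]
      by (cases zs) (auto simp: map_filter_append List.map_filter_def)
  next
    case idle then show ?thesis using Suc by simp
  qed
qed

section \<open>Two runs that agree outside one player\<close>

text \<open>Sending follows the history. Having stopped in the second run, \<open>j\<close> has
  started a round beyond its last history entry there, so even with equal histories it cannot have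
  sent more in the first run.\<close>

lemma prefix_sent_stopped:
  assumes "x j = x' j" "phase (run \<pi> x' \<omega> \<sigma> T) j = Stopped y"
    and h: "prefix (hist (run \<pi> x \<omega> \<sigma> t) j) (hist (run \<pi> x' \<omega> \<sigma> T) j)"
  shows "prefix (sent (run \<pi> x \<omega> \<sigma> t) j l) (sent (run \<pi> x' \<omega> \<sigma> T) j l)"
proof -
  let ?c = "run \<pi> x \<omega> \<sigma> t" and ?d = "run \<pi> x' \<omega> \<sigma> T"
  have v: "local_view x' \<omega> j = local_view x \<omega> j"
    using assms(1) by (simp add: local_view_def fun_eq_iff)
  have le: "rounds_started ?c j \<le> rounds_started ?d j"
    using assms(2) prefix_length_le[OF h] by (simp add: rounds_started_def)
  have "take r (hist ?c j) = take r (hist ?d j)" if "r < rounds_started ?c j" for r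
    using that by (intro prefix_take_eq[OF h]) (auto simp: rounds_started_def split: if_splits)
  then have "sent ?c j l =
      List.map_filter (\<lambda>r. send_fun \<pi> j (local_view x \<omega> j (take r (hist ?d j))) l)
        [0..<rounds_started ?c j]"
    unfolding run_sent[of \<pi> x] by (intro map_filter_cong) simp
  moreover have "prefix [0..<rounds_started ?c j] [0..<rounds_started ?d j]"
    using le by (metis le0 prefixI upt_add_eq_append le_Suc_ex)
  ultimately show ?thesis
    by (subst run_sent) (simp add: v prefix_map_filter)
qed

lemma hd_drop_prefix:
  assumes "prefix xs ys" "drop q xs \<noteq> []"
  shows "hd (drop q xs) = ys ! q" "q < length ys"
  using assms by (auto simp: hd_drop_conv_nth prefix_def nth_append)

text \<open>After cancelling the common messages \<open>zs\<close>, both next messages are prefixes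
  of the same bit string.\<close>

lemma concat_comparable:
  assumes "concat xs = concat ys" "prefix zs xs" "prefix zs ys"
    and "length zs < length xs" "length zs < length ys"
  shows "prefix (xs ! length zs) (ys ! length zs) \<or> prefix (ys ! length zs) (xs ! length zs)"
proof -
  obtain us vs where u: "xs = zs @ us" "ys = zs @ vs" using assms by (auto simp: prefix_def)
  with assms obtain a us' b vs' where "us = a # us'" "vs = b # vs'"
    by (cases us; cases vs) auto
  then show ?thesis
    using assms(1) u prefix_same_cases[of a "a @ concat us'" b] by (metis concat.simps(2) concat_append nth_append_length prefixI same_append_eq)
qed

lemma self_delimitingD:
  assumes sd: "self_delimiting k X \<pi>"
    and x: "x \<in> X" "x' \<in> X" and \<omega>: "\<omega> \<in> space (randomness_space k)"
    and \<sigma>: "\<sigma> \<in> fair_schedules k" and i: "i \<in> {1..k}"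
    and w: "phase (run \<pi> x \<omega> \<sigma> t) i = Waiting" "phase (run \<pi> x' \<omega> \<sigma> t') i = Waiting"
    and v: "view_of x \<omega> (run \<pi> x \<omega> \<sigma> t) i = view_of x' \<omega> (run \<pi> x' \<omega> \<sigma> t') i"
    and j: "j \<in> wait_fun \<pi> i (view_of x \<omega> (run \<pi> x \<omega> \<sigma> t) i)"
    and ne: "unread (run \<pi> x \<omega> \<sigma> t) j i \<noteq> []" "unread (run \<pi> x' \<omega> \<sigma> t') j i \<noteq> []"
  shows "\<not> strict_prefix (hd (unread (run \<pi> x \<omega> \<sigma> t) j i)) (hd (unread (run \<pi> x' \<omega> \<sigma> t') j i))"
  using sd[unfolded self_delimiting_def Let_def, THEN bspec, OF x(1), THEN bspec, OF \<omega>,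
      THEN bspec, OF \<sigma>, THEN spec, of t, THEN bspec, OF x(2), THEN bspec, OF \<omega>,
      THEN bspec, OF \<sigma>, THEN spec, of t', THEN bspec, OF i, THEN bspec, OF j] w v ne
  by blast

text \<open>The protocol without player \<open>i\<close> is a deterministic Kahn network driven by the streams coming
  from \<open>i\<close>: whatever the delays, no player can deviate from the messages it reads in the other run.
  Prefix-freeness makes the bit streams determine how they split into messages.\<close>

lemma run_determined:
  assumes wa: "well_addressed k \<pi>" and sd: "self_delimiting k X \<pi>"
    and x: "x \<in> X" "x' \<in> X" and \<omega>: "\<omega> \<in> space (randomness_space k)"
    and \<sigma>: "\<sigma> \<in> fair_schedules k"
    and agree: "\<And>j. j \<in> {1..k} - {i} \<Longrightarrow> x j = x' j"
    and streams: "\<And>j. j \<in> {1..k} \<Longrightarrow>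
      concat (sent (run \<pi> x \<omega> \<sigma> T) i j) = concat (sent (run \<pi> x' \<omega> \<sigma> T') i j)"
    and stopped: "\<And>j. j \<in> {1..k} \<Longrightarrow> \<exists>y. phase (run \<pi> x' \<omega> \<sigma> T') j = Stopped y"
    and "t \<le> T" "j \<in> {1..k} - {i}"
  shows "prefix (hist (run \<pi> x \<omega> \<sigma> t) j) (hist (run \<pi> x' \<omega> \<sigma> T') j)"
  using assms(10,11)
proof (induction t arbitrary: j)
  case 0
  then show ?case by (simp add: initial_config_def)
next
  case (Suc t)
  let ?c = "run \<pi> x \<omega> \<sigma> t" and ?d = "run \<pi> x' \<omega> \<sigma> T'"
  have pre: "prefix (hist ?c p) (hist ?d p)" if "p \<in> {1..k} - {i}" for p
    using Suc that by simp
  \<comment> \<open>Players other than \<open>i\<close> send according to their histories, so the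
    induction hypothesis carries over to their outgoing messages.\<close>
  have pre_sent: "prefix (sent ?c p l) (sent ?d p l)" if "p \<in> {1..k} - {i}" for p l
    using agree that stopped pre prefix_sent_stopped by (metis DiffD1)
  note prej = pre[OF Suc.prems(2)]
  show ?case
  proof (cases rule: advance_cases[of j "\<sigma> t" _ ?c \<pi> x \<omega>])
    case other then show ?thesis using prej by (simp add: advance_other)
  next
    case ready then show ?thesis using prej advance_ready(2)[OF ready(2), of \<pi> x \<omega>] by simp
  next
    case idle then show ?thesis using prej by simp
  next
    case waiting
    have v: "local_view x' \<omega> j = local_view x \<omega> j"
      using agree Suc.prems(2) by (simp add: local_view_def fun_eq_iff)
    let ?h = "hist ?c j"
    \<comment> \<open>In the first run \<open>j\<close> waits with history \<open>?h\<close>, so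
      \<open>?h\<close> yields no output, while its final history in the second run does. Hence the
      second run completes a further round after \<open>?h\<close>.\<close>
    obtain y where "phase ?d j = Stopped y" using stopped Suc.prems(2) by blast
    then have "out_fun \<pi> j (local_view x \<omega> j (hist ?d j)) = Some y"
      using run_out[of \<pi> x' \<omega> \<sigma> T' j] v by simp
    moreover have "out_fun \<pi> j (local_view x \<omega> j ?h) = None"
      using run_out[of \<pi> x \<omega> \<sigma> t j] waiting(2) by simp
    ultimately have "?h \<noteq> hist ?d j" by auto
    then have len: "length ?h < length (hist ?d j)"
      using prej prefix_length_less strict_prefixI by blast
    have h: "take (length ?h) (hist ?d j) = ?h" using prej by (auto simp: prefix_def)
    let ?W = "wait_fun \<pi> j (local_view x \<omega> j ?h)"
    obtain s where s: "s \<le> T'" "phase (run \<pi> x' \<omega> \<sigma> s) j = Waiting"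
      "hist (run \<pi> x' \<omega> \<sigma> s) j = ?h"
      "\<forall>p\<in>?W. unread (run \<pi> x' \<omega> \<sigma> s) p j \<noteq> []"
      "hist ?d j ! length ?h =
         (\<lambda>p. if p \<in> ?W then Some (hd (unread (run \<pi> x' \<omega> \<sigma> s) p j)) else None)"
    proof (rule run_read[OF len], goal_cases)
      case (1 s)
      then show ?thesis using that[of s] unfolding h v by simp
    qed
    let ?c' = "run \<pi> x' \<omega> \<sigma> s"
    have eq: "hd (unread ?c p j) = hd (unread ?c' p j)" if p: "p \<in> ?W" for p
    proof -
      have pk: "p \<in> {1..k}" using p wa Suc.prems(2) unfolding well_addressed_def by blast
      let ?ms = "List.map_filter (\<lambda>r. r p) ?h"
      let ?q = "length ?ms"
      have ne: "drop ?q (sent ?c p j) \<noteq> []" "drop ?q (sent ?c' p j) \<noteq> []"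
        using p waiting(3) s(3,4) by (auto simp: unread_def)
      have sent_d: "prefix (sent ?c' p j) (sent ?d p j)" using run_prefix(2)[OF s(1)] .
      have u: "unread ?c p j = drop ?q (sent ?c p j)" "unread ?c' p j = drop ?q (sent ?c' p j)"
        using s(3) by (simp_all add: unread_def)
      show ?thesis
      proof (cases "p = i")
        case False
        then show ?thesis
          using pk hd_drop_prefix(1)[OF pre_sent ne(1)] hd_drop_prefix(1)[OF sent_d ne(2)]
          unfolding u by simp
      next
        case True
        \<comment> \<open>The bit streams are known to agree only at the final times
          \<open>T\<close> and \<open>T'\<close>, so the two next messages are located in the final
          lists, right after the common messages \<open>?ms\<close>.\<close>
        let ?A = "sent (run \<pi> x \<omega> \<sigma> T) p j" and ?B = "sent ?d p j"
        have A: "prefix (sent ?c p j) ?A" using run_prefix(2) Suc.prems(1) by (metis Suc_leD)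
        have "prefix ?ms ?A"
          using messages_read_prefix_sent[of p \<pi> x \<omega> \<sigma> t j] A by (rule prefix_order.trans)
        moreover have "prefix ?ms ?B"
          using messages_read_prefix_sent[of p \<pi> x' \<omega> \<sigma> s j] sent_d
          unfolding s(3) by (rule prefix_order.trans)
        moreover have "concat ?A = concat ?B" using streams Suc.prems(2) True by simp
        ultimately have "prefix (?A ! ?q) (?B ! ?q) \<or> prefix (?B ! ?q) (?A ! ?q)"
          using hd_drop_prefix(2)[OF A ne(1)] hd_drop_prefix(2)[OF sent_d ne(2)]
          by (intro concat_comparable)
        moreover have "?A ! ?q = hd (unread ?c p j)" "?B ! ?q = hd (unread ?c' p j)"
          using hd_drop_prefix(1)[OF A ne(1)] hd_drop_prefix(1)[OF sent_d ne(2)]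
          unfolding u by simp_all
        moreover have "\<not> strict_prefix (hd (unread ?c p j)) (hd (unread ?c' p j))"
          using Suc.prems(2) waiting(2,3) s(2,3,4) p v x \<omega> \<sigma>
          by (intro self_delimitingD[OF sd, where i = j]) (auto simp: view_of_eq)
        moreover have "\<not> strict_prefix (hd (unread ?c' p j)) (hd (unread ?c p j))"
          using Suc.prems(2) waiting(2,3) s(2,3,4) p v x \<omega> \<sigma>
          by (intro self_delimitingD[OF sd, where i = j]) (auto simp: view_of_eq)
        ultimately show ?thesis by (metis strict_prefixI)
      qed
    qed
    have "hist (run \<pi> x \<omega> \<sigma> (Suc t)) j = ?h @ [hist ?d j ! length ?h]"
      using advance_waiting(2)[OF waiting(2,3)] waiting(1) eq s(5) by auto
    also have "\<dots> = take (Suc (length ?h)) (hist ?d j)"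
      using len h by (simp add: take_Suc_conv_app_nth)
    finally show ?thesis by (metis take_is_prefix)
  qed
qed

text \<open>The history of \<open>j\<close> in the first run is a prefix of that in the second. A
  strict prefix would yield no output although \<open>j\<close> has stopped, so the histories
  coincide.\<close>

lemma output_determined:
  assumes "well_addressed k \<pi>" "self_delimiting k X \<pi>"
    and "x \<in> X" "x' \<in> X" "\<omega> \<in> space (randomness_space k)" "\<sigma> \<in> fair_schedules k"
    and "\<And>j. j \<in> {1..k} - {i} \<Longrightarrow> x j = x' j"
    and "\<And>j. j \<in> {1..k} \<Longrightarrow>
      concat (sent (run \<pi> x \<omega> \<sigma> T) i j) = concat (sent (run \<pi> x' \<omega> \<sigma> T') i j)"
    and "\<And>j. j \<in> {1..k} \<Longrightarrow> \<exists>y. phase (run \<pi> x' \<omega> \<sigma> T') j = Stopped y"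
    and j: "j \<in> {1..k} - {i}"
    and y: "phase (run \<pi> x \<omega> \<sigma> T) j = Stopped y" and y': "phase (run \<pi> x' \<omega> \<sigma> T') j = Stopped y'"
  shows "y = y'"
proof -
  let ?c = "run \<pi> x \<omega> \<sigma> T" and ?d = "run \<pi> x' \<omega> \<sigma> T'"
  have h: "prefix (hist ?c j) (hist ?d j)"
    using run_determined[OF assms(1-9) order_refl j] by blast
  have v: "local_view x' \<omega> j = local_view x \<omega> j"
    using assms(7) j by (simp add: local_view_def fun_eq_iff)
  have "\<not> length (hist ?c j) < length (hist ?d j)"
    using run_out[of \<pi> x \<omega> \<sigma> T j] run_out[of \<pi> x' \<omega> \<sigma> T' j] y v h
    by (auto simp: prefix_def)
  then have "hist ?c j = hist ?d j" using h by (auto simp: prefix_def)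
  then show ?thesis
    using run_out[of \<pi> x \<omega> \<sigma> T j] run_out[of \<pi> x' \<omega> \<sigma> T' j] y y' v by simp
qed

section \<open>Counting tuples of bit strings\<close>

text \<open>Encodes a tuple as one word over three letters. The terminator \<open>None\<close> makes
  the encoding injective and costs one letter per string.\<close>

definition join :: "bool list list \<Rightarrow> bool option list" where
  "join ss = concat (map (\<lambda>s. map Some s @ [None]) ss)"

lemma join_simps [simp]: "join [] = []" "join (s # ss) = map Some s @ None # join ss"
  by (simp_all add: join_def)

lemma map_Some_None_eq_iff:
  "map Some s @ None # u = map Some t @ None # v \<longleftrightarrow> s = t \<and> u = v"
proof (induction s arbitrary: t)
  case Nil then show ?case by (cases t) auto
next
  case (Cons a s) then show ?case by (cases t) auto
qed

lemma inj_join: "inj join"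
proof (rule injI)
  show "ss = ts" if "join ss = join ts" for ss ts
    using that
  proof (induction ss arbitrary: ts)
    case Nil then show ?case by (cases ts) auto
  next
    case (Cons s ss) then show ?case by (cases ts) (auto simp: map_Some_None_eq_iff)
  qed
qed

lemma length_join: "length (join ss) = sum_list (map length ss) + length ss"
  by (induction ss) auto

text \<open>Under \<open>join\<close> the tuples become words of length at most \<open>L + k\<close>
  over three letters. The sum of the powers of 3 is rounded up to a power of 4, which is easy to
  compare with \<open>2 ^ n\<close>.\<close>

lemma card_string_tuples:
  defines "S \<equiv> \<lambda>k L. {ss :: bool list list. length ss = k \<and> sum_list (map length ss) \<le> L}"
  shows "finite (S k L)" and "card (S k L) \<le> 4 ^ (L + k)"
proof -
  let ?U = "{w :: bool option list. set w \<subseteq> UNIV \<and> length w \<le> L + k}"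
  have sub: "join ` S k L \<subseteq> ?U" by (auto simp: S_def length_join)
  have fin: "finite ?U" by (rule finite_lists_length_le) simp
  have inj: "inj_on join (S k L)" using inj_join by (rule inj_on_subset) simp
  show "finite (S k L)" using finite_subset[OF sub fin] inj by (rule finite_imageD)
  have "card (S k L) = card (join ` S k L)" using inj by (simp add: card_image)
  also have "\<dots> \<le> card ?U" using fin sub by (rule card_mono)
  also have "\<dots> = (\<Sum>i\<le>L + k. card (UNIV :: bool option set) ^ i)"
    by (rule card_lists_length_le) simp
  also have "card (UNIV :: bool option set) = 3" by (simp add: card_UNIV_option)
  also have "(\<Sum>i\<le>m. 3 ^ i :: nat) \<le> 4 ^ m" for m
  proof (induction m)
    case (Suc m)
    have "(3::nat) ^ m \<le> 4 ^ m" by (rule power_mono) auto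
    then show ?case using Suc by simp
  qed simp
  finally show "card (S k L) \<le> 4 ^ (L + k)" .
qed

section \<open>Averaging, parity and a fair schedule\<close>

text \<open>The expected number of events that occur is at least \<open>p * card X\<close>, so the
  number cannot be smaller at every point.\<close>

lemma (in prob_space) exists_point_in_many_events:
  assumes "finite X" and "\<And>x. x \<in> X \<Longrightarrow> A x \<in> events" and "\<And>x. x \<in> X \<Longrightarrow> p \<le> prob (A x)"
  shows "\<exists>\<omega>\<in>space M. p * card X \<le> card {x \<in> X. \<omega> \<in> A x}"
proof (rule ccontr)
  let ?f = "\<lambda>\<omega>. \<Sum>x\<in>X. indicator (A x) \<omega> :: real"
  assume "\<not> ?thesis"
  moreover have "?f \<omega> = card {x \<in> X. \<omega> \<in> A x}" for \<omega>
    using assms(1) by (simp add: indicator_def Int_def)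
  ultimately have "AE \<omega> in M. ?f \<omega> < p * card X" by (auto simp: not_le)
  then have "expectation ?f < p * card X"
    using assms by (intro expectation_less) (auto simp: emeasure_eq_measure)
  moreover have "expectation ?f = (\<Sum>x\<in>X. prob (A x))"
    using assms by (subst Bochner_Integration.integral_sum) (auto simp: emeasure_eq_measure)
  moreover have "p * card X \<le> (\<Sum>x\<in>X. prob (A x))"
    using assms(3) sum_mono[of X "\<lambda>_. p" "\<lambda>x. prob (A x)"] by (simp add: mult.commute)
  ultimately show False by simp
qed

lemma prob_space_randomness: "prob_space (randomness_space k)"
  unfolding randomness_space_def coin_space_def
  by (intro prob_space_pair prob_space_PiM prob_space_measure_pmf)

lemma finite_Par_inputs: "finite (Par_inputs k n)"
  and card_Par_inputs: "card (Par_inputs k n) = (2 ^ n) ^ k"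
proof -
  have "finite {w :: bool list. length w = n}" "card {w :: bool list. length w = n} = 2 ^ n"
    using finite_lists_length_eq[of "UNIV :: bool set" n] card_lists_length_eq[of "UNIV :: bool set" n]
    by simp_all
  then show "finite (Par_inputs k n)" "card (Par_inputs k n) = (2 ^ n) ^ k"
    unfolding Par_inputs_def by (auto simp: card_PiE intro!: finite_PiE)
qed

text \<open>At each position the contributions of the other players cancel, so the parity reveals
  the bit of \<open>i\<close>.\<close>

lemma Par_determines_input:
  assumes x: "x \<in> Par_inputs k n" "x' \<in> Par_inputs k n"
    and i: "i \<in> {1..k}" and agree: "\<And>j. j \<in> {1..k} - {i} \<Longrightarrow> x j = x' j"
    and Par: "Par k n x 1 = Par k n x' 1"
  shows "x = x'"
proof -
  have "x i = x' i"
  proof (rule nth_equalityI)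
    show len: "length (x i) = length (x' i)" using x i by (auto simp: Par_inputs_def PiE_iff)
    fix p assume "p < length (x i)"
    then have "p < n" using x i by (auto simp: Par_inputs_def PiE_iff)
    then have "odd (\<Sum>j=1..k. of_bool (x j ! p) :: nat) = odd (\<Sum>j=1..k. of_bool (x' j ! p) :: nat)"
      using Par by (auto simp: Par_def)
    moreover have "(\<Sum>j\<in>{1..k} - {i}. of_bool (x j ! p) :: nat) = (\<Sum>j\<in>{1..k} - {i}. of_bool (x' j ! p))"
      using agree by (intro sum.cong) auto
    ultimately show "x i ! p = x' i ! p"
      using i sum.remove[of "{1..k}" i "\<lambda>j. of_bool (x j ! p) :: nat"]
        sum.remove[of "{1..k}" i "\<lambda>j. of_bool (x' j ! p) :: nat"]
      by (cases "x i ! p"; cases "x' i ! p") (simp_all del: sum_of_bool_eq)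
  qed
  then show ?thesis
    using x agree by (intro PiE_ext[of x "{1..k}" "\<lambda>_. {w. length w = n}"]) (auto simp: Par_inputs_def)
qed

lemma round_robin_fair:
  assumes "0 < k"
  shows "(\<lambda>t. Suc (t mod k)) \<in> fair_schedules k"
proof -
  have "infinite {t. Suc (t mod k) = i}" if i: "i \<in> {1..k}" for i
  proof -
    \<comment> \<open>Player \<open>i\<close> acts at the times congruent to \<open>i - 1\<close>
      modulo \<open>k\<close>.\<close>
    have "inj (\<lambda>m. m * k + (i - 1))" using assms by (auto intro: injI)
    then have "infinite (range (\<lambda>m. m * k + (i - 1)))" by (rule range_inj_infinite)
    moreover have "(m * k + (i - 1)) mod k = i - 1" for m
      using i by (simp only: mod_mult_self3 mod_less) auto
    then have "range (\<lambda>m. m * k + (i - 1)) \<subseteq> {t. Suc (t mod k) = i}"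
      using i by (auto simp del: mod_mult_self3)
    ultimately show ?thesis using finite_subset by blast
  qed
  then show ?thesis using assms by (auto simp: fair_schedules_def Suc_leI)
qed

text \<open>Values all below \<open>b\<close> on \<open>C\<close> would sum to less than
  \<open>b * card C\<close>, which is at most \<open>b * card X\<close>.\<close>

lemma exists_ge_average:
  fixes f :: "'a \<Rightarrow> real" and b :: real
  assumes "finite X" "C \<subseteq> X" "0 < b" "C \<noteq> {}" and "b * card X \<le> (\<Sum>x\<in>C. f x)"
  shows "\<exists>x\<in>C. b \<le> f x"
proof (rule ccontr)
  assume "\<not> ?thesis"
  then have "(\<Sum>x\<in>C. f x) < (\<Sum>x\<in>C. b)"
    using assms finite_subset by (intro sum_strict_mono) (auto simp: not_le)
  also have "\<dots> \<le> b * card X" using assms by (simp add: card_mono)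
  finally show False using assms(5) by simp
qed

section \<open>The lower bound for a single protocol\<close>

text \<open>The 64 is the product of 4 (a quarter of the inputs), 8 (\<open>n / 8\<close> bits each)
  and 2 (from k - 1 \<ge> k / 2).\<close>

lemma protocol_bits_lower_bound:
  assumes k: "2 \<le> k" and n: "8 * k \<le> n" and \<epsilon>: "\<epsilon> < 1 / 2"
    and wa: "well_addressed k \<pi>" and sd: "self_delimiting k (Par_inputs k n) \<pi>"
    and comp: "eps_computes k (Par_inputs k n) (Par k n) \<epsilon> \<pi>"
  shows "\<exists>x\<in>Par_inputs k n. \<exists>\<omega>\<in>space (randomness_space k). \<exists>\<sigma>\<in>fair_schedules k. \<exists>t.
    real k * real n / 64 \<le> real (bits_sent k (run \<pi> x \<omega> \<sigma> t))"
proof -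
  define X where "X = Par_inputs k n"
  define \<sigma> where "\<sigma> t = Suc (t mod k)" for t
  have \<sigma>: "\<sigma> \<in> fair_schedules k" using round_robin_fair[of k] k unfolding \<sigma>_def by simp
  have finX: "finite X" and cardX: "card X = (2 ^ n) ^ k"
    unfolding X_def by (rule finite_Par_inputs card_Par_inputs)+
  interpret prob_space "randomness_space k" by (rule prob_space_randomness)
  have "\<exists>\<omega>\<in>space (randomness_space k). (1 - \<epsilon>) * card X \<le>
      card {x \<in> X. \<omega> \<in> {\<omega> \<in> space (randomness_space k). outputs_correct k (Par k n) \<pi> x \<omega>}}"
    using comp finX unfolding eps_computes_def X_def
    by (intro exists_point_in_many_events) auto
  then obtain \<omega> where \<omega>: "\<omega> \<in> space (randomness_space k)"
    and "(1 - \<epsilon>) * card X \<le> card {x \<in> X. outputs_correct k (Par k n) \<pi> x \<omega>}" by auto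
  moreover define C where "C = {x \<in> X. outputs_correct k (Par k n) \<pi> x \<omega>}"
  moreover have "card X / 2 \<le> (1 - \<epsilon>) * card X"
    using mult_right_mono[of "1 / 2" "1 - \<epsilon>" "real (card X)"] \<epsilon> by simp
  ultimately have cardC: "card X / 2 \<le> card C" by simp
  have finC: "finite C" and CX: "C \<subseteq> X" using finX by (auto simp: C_def)

  have "\<exists>T. \<forall>i\<in>{1..k}. \<exists>y. phase (run \<pi> x \<omega> \<sigma> T) i = Stopped y" if "x \<in> X" for x
  proof -
    have "\<forall>i\<in>{1..k}. \<exists>t y. phase (run \<pi> x \<omega> \<sigma> t) i = Stopped y"
      using comp that \<omega> \<sigma> by (auto simp: eps_computes_def X_def)
    then obtain t where t: "\<forall>i\<in>{1..k}. \<exists>y. phase (run \<pi> x \<omega> \<sigma> (t i)) i = Stopped y"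
      by metis
    \<comment> \<open>Stopping is permanent, so the latest stopping time serves all players.\<close>
    have "t i \<le> Max (t ` {1..k})" if "i \<in> {1..k}" for i using that by simp
    then show ?thesis using t run_stopped by metis
  qed
  then obtain T where T: "\<And>x i. x \<in> X \<Longrightarrow> i \<in> {1..k} \<Longrightarrow>
      \<exists>y. phase (run \<pi> x \<omega> \<sigma> (T x)) i = Stopped y" by metis
  define c where "c x = run \<pi> x \<omega> \<sigma> (T x)" for x
  have out: "phase (c x) 1 = Stopped (the (Par k n x 1))" if "x \<in> C" for x
  proof -
    have "outputs_correct k (Par k n) \<pi> x \<omega>" "x \<in> X" using that by (auto simp: C_def)
    moreover have "Par k n x 1 = Some (the (Par k n x 1))" by (simp add: Par_def)
    moreover have "1 \<in> {1..k}" using k by simp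
    ultimately obtain t y where "phase (run \<pi> x \<omega> \<sigma> t) 1 = Stopped (the (Par k n x 1))"
      and "phase (c x) 1 = Stopped y"
      using \<sigma> T unfolding outputs_correct_def c_def by blast
    \<comment> \<open>At the later of the two times both outputs persist, hence they
      coincide.\<close>
    then show ?thesis
      unfolding c_def using run_stopped[of t "max t (T x)" \<pi> x \<omega> \<sigma> 1]
        run_stopped[of "T x" "max t (T x)" \<pi> x \<omega> \<sigma> 1] by simp
  qed

  \<comment> \<open>Message boundaries are forgotten, so that the number of possible stream tuples
    is controlled by the bits sent, however many messages carry them.\<close>
  define streams where "streams x i = map (\<lambda>j. concat (sent (c x) i j)) [1..<Suc k]" for x i
  define len where "len x i = sum_list (map length (streams x i))" for x i
  have len_eq: "len x i = (\<Sum>j=1..k. sum_list (map length (sent (c x) i j)))" for x i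
    unfolding len_def streams_def
    by (simp only: map_map o_def length_concat interv_sum_list_conv_sum_set_nat set_upt
        atLeastLessThanSuc_atLeastAtMost)
  define L where "L = n div 8"
  define B where "B i = {x \<in> C. len x i \<le> L}" for i

  \<comment> \<open>The inputs of the others and the streams of \<open>i\<close> encode an input in
    \<open>B i\<close>. Decoding uses the output of player 1, and \<open>output_determined\<close>
    covers only players other than \<open>i\<close>; hence the range starts at 2.\<close>
  have few_bad: "4 * card (B i) \<le> card X" if i: "i \<in> {2..k}" for i
  proof -
    define S where "S = {ss :: bool list list. length ss = k \<and> sum_list (map length ss) \<le> L}"
    define R where "R = (\<Pi>\<^sub>E j\<in>{1..k} - {i}. {w :: bool list. length w = n})"
    let ?enc = "\<lambda>x. (restrict x ({1..k} - {i}), streams x i)"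
    have "inj_on ?enc (B i)"
    proof (rule inj_onI)
      fix x x' assume xB: "x \<in> B i" "x' \<in> B i" and enc: "?enc x = ?enc x'"
      then have x: "x \<in> C" "x' \<in> C" "x \<in> X" "x' \<in> X" by (auto simp: B_def C_def)
      have agree: "x j = x' j" if "j \<in> {1..k} - {i}" for j
        using enc that by (metis Pair_inject restrict_apply')
      have "\<forall>j\<in>set [1..<Suc k]. concat (sent (c x) i j) = concat (sent (c x') i j)"
        using enc unfolding streams_def prod.inject map_eq_conv by blast
      moreover have "set [1..<Suc k] = {1..k}" by auto
      ultimately have same: "concat (sent (c x) i j) = concat (sent (c x') i j)"
        if "j \<in> {1..k}" for j
        using that by (simp only:)
      have "1 \<in> {1..k} - {i}" using i k by auto
      then have "the (Par k n x 1) = the (Par k n x' 1)"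
        using output_determined[OF wa sd[folded X_def] x(3,4) \<omega> \<sigma> agree same[unfolded c_def]
            T[OF x(4)] _ out[OF x(1), unfolded c_def] out[OF x(2), unfolded c_def]]
        by simp
      then have "Par k n x 1 = Par k n x' 1" by (simp add: Par_def)
      then show "x = x'"
        using x i agree Par_determines_input[of x k n x' i] unfolding X_def by simp
    qed
    moreover have "?enc ` B i \<subseteq> R \<times> S"
    proof
      fix z assume "z \<in> ?enc ` B i"
      then obtain x where x: "x \<in> B i" "z = ?enc x" by auto
      then have "restrict x ({1..k} - {i}) \<in> R"
        by (auto simp: R_def B_def C_def X_def Par_inputs_def PiE_iff)
      moreover have "streams x i \<in> S"
        using x unfolding S_def B_def len_def by (simp add: streams_def)
      ultimately show "z \<in> R \<times> S" using x by simp
    qed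
    moreover have finR: "finite R" unfolding R_def
      using finite_lists_length_eq[of "UNIV :: bool set" n] by (intro finite_PiE) auto
    ultimately have "card (B i) \<le> card R * card S"
      using card_inj_on_le[of ?enc "B i" "R \<times> S"] card_string_tuples(1)[of k L]
      by (simp add: S_def card_cartesian_product)
    also have "card R = (2 ^ n) ^ (k - 1)"
      using i card_lists_length_eq[of "UNIV :: bool set" n] by (simp add: R_def card_PiE)
    also have "card S \<le> 4 ^ (L + k)" unfolding S_def by (rule card_string_tuples(2))
    finally have "4 * card (B i) \<le> (2 ^ n) ^ (k - 1) * (4 * 4 ^ (L + k))" by simp
    also have "(4::nat) * 4 ^ (L + k) = 2 ^ (2 * (1 + L + k))"
      unfolding power_mult by simp
    \<comment> \<open>The factor 4 has become the 1 in the exponent. From 2 \<le> k and 8 k \<le> n,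
      each of 2, \<open>L\<close> and \<open>k\<close> is at most n / 8, so the exponent is at most
      5 n / 8.\<close>
    also have "(2::nat) ^ (2 * (1 + L + k)) \<le> 2 ^ n"
      using k n unfolding L_def by (intro power_increasing) auto
    also have "(2 ^ n) ^ (k - 1) * 2 ^ n = card X"
      using k unfolding cardX by (cases k) auto
    finally show ?thesis by simp
  qed

  have each: "real (card X) / 4 * (real n / 8) \<le> (\<Sum>x\<in>C. real (len x i))" if i: "i \<in> {2..k}" for i
  proof -
    have "card C = card (B i) + card (C - B i)"
      using finC by (metis (no_types, lifting) B_def card_Diff_subset card_mono finite_subset le_add_diff_inverse
          mem_Collect_eq subsetI)
    \<comment> \<open>Correct inputs fill at least half of \<open>X\<close>, those in
      \<open>B i\<close> at most a quarter.\<close>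
    then have "real (card X) / 4 \<le> card (C - B i)" using cardC few_bad[OF i] by linarith
    then have "real (card X) / 4 * (real n / 8) \<le> card (C - B i) * (real n / 8)"
      by (rule mult_right_mono) simp
    also have "\<dots> = (\<Sum>x\<in>C - B i. real n / 8)" by simp
    also have "\<dots> \<le> (\<Sum>x\<in>C - B i. real (len x i))"
    proof (rule sum_mono)
      fix x assume "x \<in> C - B i"
      \<comment> \<open>Exceeding the rounded-down quotient strictly makes up for the
        rounding.\<close>
      then have "n div 8 < len x i" by (auto simp: B_def L_def)
      then show "real n / 8 \<le> real (len x i)" by linarith
    qed
    also have "\<dots> \<le> (\<Sum>x\<in>C. real (len x i))" using finC by (intro sum_mono2) auto
    finally show ?thesis .
  qed

  have "real k * real n / 64 * card X \<le> real (k - 1) * (real (card X) / 4 * (real n / 8))"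
  proof -
    have "real k / 2 \<le> real (k - 1)" using k by simp
    then have "real k / 2 * (real n * card X / 32) \<le> real (k - 1) * (real n * card X / 32)"
      by (rule mult_right_mono) simp
    then show ?thesis by (simp add: mult_ac)
  qed
  also have "\<dots> = (\<Sum>i\<in>{2..k}. real (card X) / 4 * (real n / 8))" using k by simp
  also have "\<dots> \<le> (\<Sum>i\<in>{2..k}. \<Sum>x\<in>C. real (len x i))" by (rule sum_mono) (rule each)
  also have "\<dots> = (\<Sum>x\<in>C. \<Sum>i\<in>{2..k}. real (len x i))" by (rule sum.swap)
  also have "\<dots> \<le> (\<Sum>x\<in>C. real (bits_sent k (c x)))"
  proof (rule sum_mono)
    fix x
    have "(\<Sum>i\<in>{2..k}. len x i) \<le> (\<Sum>i\<in>{1..k}. len x i)" by (rule sum_mono2) auto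
    then show "(\<Sum>i\<in>{2..k}. real (len x i)) \<le> real (bits_sent k (c x))"
      unfolding bits_sent_def len_eq by (metis of_nat_le_iff of_nat_sum)
  qed
  finally have sum: "real k * real n / 64 * card X \<le> (\<Sum>x\<in>C. real (bits_sent k (c x)))" .
  have "0 < card X" unfolding cardX by simp
  then have "C \<noteq> {}" using cardC by auto
  then obtain x where "x \<in> C" "real k * real n / 64 \<le> bits_sent k (c x)"
    using exists_ge_average[OF finX CX _ _ sum] k n by (auto simp: zero_less_mult_iff)
  then show ?thesis using \<omega> \<sigma> unfolding c_def C_def X_def by blast
qed

section \<open>Passing to the infimum over all protocols\<close>

theorem theorem4p3:
  fixes \<epsilon> :: real
  assumes "0 \<le> \<epsilon>" and "\<epsilon> < 1 / 2"
  shows "\<exists>\<alpha>::real. \<alpha> > 0 \<and> (\<exists>c::real. c > 0 \<and>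
    (\<forall>k n::nat. 2 \<le> k \<longrightarrow> real n \<ge> 1 / \<alpha> * real k \<longrightarrow>
       ereal_of_enat (CC_eps k (Par_inputs k n) (Par k n) \<epsilon>) \<ge> ereal (c * real k * real n)))"
proof (rule exI[of _ "1 / 8"], rule conjI, simp, rule exI[of _ "1 / 64"], intro conjI allI impI)
  fix k n :: nat
  assume k: "2 \<le> k" and "1 / (1 / 8) * real k \<le> real n"
  then have "real (8 * k) \<le> real n" by simp
  then have n: "8 * k \<le> n" by (simp only: of_nat_le_iff)
  \<comment> \<open>Complexities are extended naturals, so the real bound is rounded up before it is
    compared with the suprema and the infimum.\<close>
  define m where "m = nat \<lceil>real k * real n / 64\<rceil>"
  have "enat m \<le> CC_eps k (Par_inputs k n) (Par k n) \<epsilon>"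
    unfolding CC_eps_def
  proof (rule Inf_greatest, clarsimp)
    fix \<pi> :: "bool list protocol"
    assume "well_addressed k \<pi>" "self_delimiting k (Par_inputs k n) \<pi>"
      "eps_computes k (Par_inputs k n) (Par k n) \<epsilon> \<pi>"
    then obtain x \<omega> \<sigma> t where *: "x \<in> Par_inputs k n" "\<omega> \<in> space (randomness_space k)"
      "\<sigma> \<in> fair_schedules k" "real k * real n / 64 \<le> real (bits_sent k (run \<pi> x \<omega> \<sigma> t))"
      using protocol_bits_lower_bound[OF k n assms(2)] by blast
    then have "enat m \<le> enat (bits_sent k (run \<pi> x \<omega> \<sigma> t))"
      unfolding m_def by (simp add: ceiling_le_iff nat_le_iff)
    then show "enat m \<le> CC_protocol k (Par_inputs k n) \<pi>"
      unfolding CC_protocol_def using *(1-3) by (blast intro: SUP_upper2)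
  qed
  then have "ereal_of_enat (enat m) \<le> ereal_of_enat (CC_eps k (Par_inputs k n) (Par k n) \<epsilon>)"
    by (simp only: ereal_of_enat_le_iff)
  moreover have "ereal (1 / 64 * real k * real n) \<le> ereal_of_enat (enat m)"
    unfolding m_def using real_nat_ceiling_ge[of "real k * real n / 64"] by simp
  ultimately show "ereal (1 / 64 * real k * real n)
      \<le> ereal_of_enat (CC_eps k (Par_inputs k n) (Par k n) \<epsilon>)"
    by (rule order_trans[rotated])
qed simp_all

end
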